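(* Let $p\ge1$, $r\ge1$, $n\ge1$ be integers, let $a\in\mathbb{R}^n$ with $y=\sum_{i=1}^n a_i\ne0$, and let $\widehat{y}$ be the result of computing $y$ by recursive summation with limited-precision stochastic rounding $\mathrm{SR}_{p,r}$, that is, $\widehat{s}_1=a_1$, $\widehat{s}_k=\mathrm{SR}_{p,r}(\widehat{s}_{k-1}+a_k)$ for $k=2,\ldots,n$, and $\widehat{y}=\widehat{s}_n$. Then $$\frac{|\mathbb{E}(\widehat{y})-y|}{|y|}\le \kappa(a)\,\gamma_{n-1}(u_{p+r}).$$
   Context: Notation: $u_q=2^{1-q}$ for an integer $q\ge1$; $\gamma_m(u)=(1+u)^m-1$; $\kappa(a)=\dfrac{\sum_{i=1}^n|a_i|}{\left|\sum_{i=1}^n a_i\right|}$ is the condition number of the sum. Floating-point numbers: $\mathcal{F}$ is the precision-$p$ binary floating-point system, i.e. the set of $0$ and all real numbers $(-1)^s 2^e m$ with $s\in\{0,1\}$, $e$ an integer exponent, and $m\in[1,2)$ having at most $p$ significant bits. Standard model: no underflow or overflow occurs (the exponent range may be regarded as unlimited). For $x\in\mathbb{R}$, $\lceil x\rceil_p=\min\{y\in\mathcal{F}:y\ge x\}$ and $\lfloor x\rfloor_p=\max\{y\in\mathcal{F}:y\le x\}$. For $x\neq0$ written uniquely as $x=(-1)^s2^em$ with $m\in[1,2)$ real, $\mathrm{ulp}_p(x)=2^{e-p+1}$, and $\mathrm{fl}_{p+r}(x)$ is $x$ with the binary expansion of its significand $m$ truncated to the first $p+r$ significant bits; $\mathrm{fl}_{p+r}(0)=0$.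 Limited-precision stochastic rounding with $r$ random bits: $\mathrm{SR}_{p,r}(0)=0$, and for $x\ne0$, $\mathrm{SR}_{p,r}(x)$ is the random variable equal to $\lceil x\rceil_p$ with probability $q_r(x)$ and to $\lfloor x\rfloor_p$ with probability $1-q_r(x)$, where $q_r(x)=(\mathrm{fl}_{p+r}(x)-\lfloor x\rfloor_p)/\mathrm{ulp}_p(x)$. In an algorithm, the inputs are deterministic and each rounding, conditionally on all previous roundings, has this two-point distribution with $x$ the exact result of the current operation. *)

theory Defs
  imports "HOL-Probability.Probability"
begin

definition unit_roundoff :: "nat \<Rightarrow> real" where
  "unit_roundoff q = 2 powi (1 - int q)"

definition gamma_bound :: "nat \<Rightarrow> real \<Rightarrow> real" where
  "gamma_bound m u = (1 + u) ^ m - 1"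

definition cond_sum :: "nat \<Rightarrow> (nat \<Rightarrow> real) \<Rightarrow> real" where
  "cond_sum n a = (\<Sum>i=1..n. \<bar>a i\<bar>) / \<bar>\<Sum>i=1..n. a i\<bar>"

text \<open>A significand \<open>m\<close> in \<open>[1,2)\<close> has at most \<open>p\<close> significant bits (one before
  and \<open>p - 1\<close> after the binary point) iff \<open>m * 2 ^ (p - 1)\<close> is an integer.
  This and the subtraction on naturals presuppose \<open>p \<ge> 1\<close>.\<close>

definition fp_numbers :: "nat \<Rightarrow> real set" where
  "fp_numbers p = {0} \<union>
    {(-1) ^ s * 2 powi e * m | (s::nat) (e::int) (m::real).
       s \<in> {0, 1} \<and> 1 \<le> m \<and> m < 2 \<and> m * 2 ^ (p - 1) \<in> \<int>}"

definition fp_ceil :: "nat \<Rightarrow> real \<Rightarrow> real" where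
  "fp_ceil p x = (LEAST y. y \<in> fp_numbers p \<and> y \<ge> x)"

definition fp_floor :: "nat \<Rightarrow> real \<Rightarrow> real" where
  "fp_floor p x = (GREATEST y. y \<in> fp_numbers p \<and> y \<le> x)"

text \<open>Exponent and significand are only meaningful for nonzero arguments.\<close>

definition expo :: "real \<Rightarrow> int" where
  "expo x = (THE e. \<exists>s\<in>{0, 1::nat}. \<exists>m. 1 \<le> m \<and> m < 2 \<and> x = (-1) ^ s * 2 powi e * m)"

definition significand :: "real \<Rightarrow> real" where
  "significand x = \<bar>x\<bar> / 2 powi expo x"

definition ulp :: "nat \<Rightarrow> real \<Rightarrow> real" where
  "ulp p x = 2 powi (expo x - int p + 1)"

text \<open>Truncation of the binary expansion of the significand to its first \<open>q\<close> bits, the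
  leading one included (so rounding is towards zero). Since \<open>sgn 0 = 0\<close>, zero is
  mapped to zero.\<close>

definition fl_trunc :: "nat \<Rightarrow> real \<Rightarrow> real" where
  "fl_trunc q x =
    sgn x * 2 powi expo x * (of_int \<lfloor>significand x * 2 ^ (q - 1)\<rfloor> / 2 ^ (q - 1))"

definition sr_prob :: "nat \<Rightarrow> nat \<Rightarrow> real \<Rightarrow> real" where
  "sr_prob p r x = (fl_trunc (p + r) x - fp_floor p x) / ulp p x"

text \<open>\<open>bernoulli_pmf\<close> clips its parameter to \<open>[0,1]\<close>; by lemma \<open>sr_prob_bounds\<close> below
  the clipping never takes effect.\<close>

definition SR :: "nat \<Rightarrow> nat \<Rightarrow> real \<Rightarrow> real pmf" where
  "SR p r x =
    (if x = 0 then return_pmf 0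
     else map_pmf (\<lambda>b. if b then fp_ceil p x else fp_floor p x)
            (bernoulli_pmf (sr_prob p r x)))"

text \<open>The law of the \<open>k\<close>-th computed partial sum, for \<open>k \<ge> 1\<close>. Monadic sequencing says that,
  conditionally on all previous roundings, the \<open>k\<close>-th partial sum is distributed as \<open>SR\<close> of the
  exact result of the current addition. The value at index 0 is a dummy.\<close>

fun sr_sum :: "nat \<Rightarrow> nat \<Rightarrow> (nat \<Rightarrow> real) \<Rightarrow> nat \<Rightarrow> real pmf" where
  "sr_sum p r a 0 = return_pmf 0"
| "sr_sum p r a (Suc 0) = return_pmf (a 1)"
| "sr_sum p r a (Suc (Suc k)) =
     bind_pmf (sr_sum p r a (Suc k)) (\<lambda>s. SR p r (s + a (Suc (Suc k))))"

lemma expo_eqI: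
  assumes "2 powi e \<le> \<bar>x\<bar>" "\<bar>x\<bar> < 2 powi (e + 1)"
  shows "expo x = e"
  unfolding expo_def
proof (rule the_equality)
  have pos: "(0::real) < 2 powi e" by simp
  define m where "m = \<bar>x\<bar> / 2 powi e"
  have m: "1 \<le> m" "m < 2" "\<bar>x\<bar> = 2 powi e * m"
    using assms pos by (auto simp: m_def power_int_add field_simps)
  show "\<exists>s\<in>{0, 1::nat}. \<exists>m. 1 \<le> m \<and> m < 2 \<and> x = (-1) ^ s * 2 powi e * m"
    using m by (cases "x \<ge> 0") (auto intro!: exI[of _ m])
next
  fix e' assume "\<exists>s\<in>{0, 1::nat}. \<exists>m. 1 \<le> m \<and> m < 2 \<and> x = (-1) ^ s * 2 powi e' * m"
  then obtain s :: nat and m where m: "1 \<le> m" "m < 2" "x = (-1) ^ s * 2 powi e' * m" by blast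
  then have ax: "\<bar>x\<bar> = 2 powi e' * m" by (simp add: abs_mult)
  have pos: "(0::real) < 2 powi e'" by simp
  have 1: "2 powi e' \<le> \<bar>x\<bar>" "\<bar>x\<bar> < 2 powi (e' + 1)"
    using m pos unfolding ax by (auto simp: power_int_add)
  have "(2::real) powi e' < 2 powi (e + 1)" "(2::real) powi e < 2 powi (e' + 1)"
    using 1 assms by linarith+
  then have "e' < e + 1" "e < e' + 1"
    by (meson not_less power_int_increasing one_le_numeral)+
  then show "e' = e" by simp
qed

lemma expo_bounds:
  assumes "x \<noteq> 0"
  shows "2 powi expo x \<le> \<bar>x\<bar>" "\<bar>x\<bar> < 2 powi (expo x + 1)"
proof -
  define e where "e = \<lfloor>log 2 \<bar>x\<bar>\<rfloor>"
  have "2 powr real_of_int e \<le> \<bar>x\<bar>" "\<bar>x\<bar> < 2 powr real_of_int (e + 1)"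
    using assms by (auto simp: e_def powr_le_iff less_powr_iff)
  then have *: "2 powi e \<le> \<bar>x\<bar>" "\<bar>x\<bar> < 2 powi (e + 1)"
    using powr_real_of_int'[of 2 e] powr_real_of_int'[of 2 "e + 1"] by simp_all
  then show "2 powi expo x \<le> \<bar>x\<bar>" "\<bar>x\<bar> < 2 powi (expo x + 1)"
    using expo_eqI[OF *] by auto
qed

lemma ulp_mult:
  assumes "p \<ge> 1"
  shows "ulp p x * 2 ^ (p - 1) = 2 powi expo x"
proof -
  have "ulp p x * 2 powi int (p - 1) = 2 powi (expo x - int p + 1 + int (p - 1))"
    unfolding ulp_def by (rule power_int_add [symmetric]) simp
  also have "expo x - int p + 1 + int (p - 1) = expo x" using assms by simp
  finally show ?thesis by simp
qed

lemma ulp_pos: "ulp p x > 0"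
  by (simp add: ulp_def)

lemma ulp_grid_mem:
  assumes p: "p \<ge> 1" and k: "2 ^ (p - 1) \<le> \<bar>k::int\<bar>" "\<bar>k\<bar> \<le> 2 ^ p"
  shows "ulp p x * of_int k \<in> fp_numbers p"
proof -
  define s :: nat where "s = (if k < 0 then 1 else 0)"
  have sk: "of_int k = (-1) ^ s * real_of_int \<bar>k\<bar>" "s \<in> {0, 1}" by (auto simp: s_def)
  have g: "ulp p x = 2 powi expo x / 2 ^ (p - 1)"
    using ulp_mult[OF p, of x] by (simp add: field_simps)
  have pp: "(2::real) ^ p = 2 * 2 ^ (p - 1)"
    using p by (metis Suc_diff_1 less_le_trans power_Suc zero_less_one)
  show ?thesis
  proof (cases "\<bar>k\<bar> = 2 ^ p")
    case True
    then have "real_of_int \<bar>k\<bar> = 2 ^ p" by simp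
    then have "ulp p x * of_int k = (-1) ^ s * 2 powi (expo x + 1) * 1"
      unfolding sk(1) g by (simp add: pp power_int_add)
    moreover have "(1::real) * 2 ^ (p - 1) \<in> \<int>" by simp
    ultimately show ?thesis unfolding fp_numbers_def using sk(2) by fastforce
  next
    case False
    define m where "m = real_of_int \<bar>k\<bar> / 2 ^ (p - 1)"
    have "real_of_int (2 ^ (p - 1)) \<le> real_of_int \<bar>k\<bar>" "real_of_int \<bar>k\<bar> < real_of_int (2 ^ p)"
      using k False by (simp_all only: of_int_le_iff of_int_less_iff)
    then have "1 \<le> m" "m < 2" "m * 2 ^ (p - 1) \<in> \<int>"
      by (auto simp: m_def pp field_simps)
    moreover have "ulp p x * of_int k = (-1) ^ s * 2 powi expo x * m"
      unfolding sk(1) g m_def by simp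
    ultimately show ?thesis unfolding fp_numbers_def using sk(2) by blast
  qed
qed

lemma ulp_gridI:
  assumes p: "p \<ge> 1" and y: "y \<in> fp_numbers p" "2 powi expo x \<le> \<bar>y\<bar>"
  obtains k :: int where "y = ulp p x * of_int k"
proof -
  have "(0::real) < 2 powi expo x" by simp
  then have "y \<noteq> 0" using y(2) by linarith
  then obtain s :: nat and e m where m: "1 \<le> m" "m < 2" "m * 2 ^ (p - 1) \<in> \<int>"
      "y = (-1) ^ s * 2 powi e * m"
    using y(1) unfolding fp_numbers_def by auto
  then obtain j :: int where j: "m * 2 ^ (p - 1) = of_int j" by (auto elim: Ints_cases)
  have "\<bar>y\<bar> = 2 powi e * m" using m by (simp add: abs_mult)
  also have "\<dots> < 2 powi e * 2" using m(2) by (intro mult_strict_left_mono) auto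
  also have "\<dots> = 2 powi (e + 1)" by (simp add: power_int_add)
  finally have "(2::real) powi expo x < 2 powi (e + 1)" using y(2) by linarith
  then have "expo x < e + 1" by (meson not_less power_int_increasing one_le_numeral)
  then obtain d where d: "e = expo x + int d" using zle_iff_zadd[of "expo x" e] by auto
  have "y = (-1) ^ s * (2 powi expo x * 2 ^ d) * m" by (simp add: m(4) d power_int_add)
  also have "\<dots> = ulp p x * ((-1) ^ s * 2 ^ d * (m * 2 ^ (p - 1)))"
    unfolding ulp_mult[OF p, of x, symmetric] by simp
  also have "\<dots> = ulp p x * of_int ((-1) ^ s * 2 ^ d * j)" unfolding j by simp
  finally show ?thesis by (rule that)
qed

lemma ulp_scaled_bounds:
  assumes p: "p \<ge> 1" and x: "x \<noteq> 0"
  shows "2 ^ (p - 1) \<le> \<bar>x / ulp p x\<bar>" "\<bar>x / ulp p x\<bar> < 2 ^ p"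
proof -
  have pp: "(2::real) ^ p = 2 * 2 ^ (p - 1)"
    using p by (metis Suc_diff_1 less_le_trans power_Suc zero_less_one)
  have "ulp p x * 2 ^ (p - 1) \<le> \<bar>x\<bar>" "\<bar>x\<bar> < ulp p x * 2 ^ p"
    using expo_bounds[OF x] ulp_mult[OF p, of x] by (simp_all add: pp power_int_add)
  then show "2 ^ (p - 1) \<le> \<bar>x / ulp p x\<bar>" "\<bar>x / ulp p x\<bar> < 2 ^ p"
    using ulp_pos[of p x] by (simp_all add: field_simps)
qed

lemma fp_floor_eq:
  assumes p: "p \<ge> 1" and x: "x \<noteq> 0"
  shows "fp_floor p x = ulp p x * of_int \<lfloor>x / ulp p x\<rfloor>"
  unfolding fp_floor_def
proof (rule Greatest_equality)
  let ?g = "ulp p x" and ?k = "\<lfloor>x / ulp p x\<rfloor>"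
  note g = ulp_pos[of p x]
  note b = ulp_scaled_bounds[OF p x]
  have k1: "2 ^ (p - 1) \<le> \<bar>?k\<bar>" and k2: "\<bar>?k\<bar> \<le> 2 ^ p"
  proof -
    have "2 ^ (p - 1) \<le> \<bar>?k\<bar> \<and> \<bar>?k\<bar> \<le> 2 ^ p"
    proof (cases "x > 0")
      case True
      then have "x / ?g > 0" using g by simp
      then have "real_of_int (2 ^ (p - 1)) \<le> x / ?g" "x / ?g < real_of_int (2 ^ p)"
        using b by (simp_all only: of_int_power of_int_numeral abs_of_pos)
      then have "2 ^ (p - 1) \<le> ?k" "?k < 2 ^ p"
        unfolding le_floor_iff floor_less_iff .
      moreover have "(0::int) < 2 ^ (p - 1)" by simp
      ultimately show ?thesis by linarith
    next
      case False
      then have "x / ?g < 0" using g x by (simp add: divide_neg_pos)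
      then have "x / ?g \<le> real_of_int (- (2 ^ (p - 1)))" "real_of_int (- (2 ^ p)) \<le> x / ?g"
        using b unfolding of_int_minus of_int_power of_int_numeral by linarith+
      then have "?k \<le> - (2 ^ (p - 1))" "- (2 ^ p) \<le> ?k"
        by (simp_all only: le_floor_iff) linarith
      moreover have "(0::int) < 2 ^ (p - 1)" by simp
      ultimately show ?thesis by linarith
    qed
    then show "2 ^ (p - 1) \<le> \<bar>?k\<bar>" "\<bar>?k\<bar> \<le> 2 ^ p" by auto
  qed
  have "of_int ?k \<le> x / ?g" by simp
  then have "?g * of_int ?k \<le> x" using g by (simp only: pos_le_divide_eq mult.commute)
  then show "?g * of_int ?k \<in> fp_numbers p \<and> ?g * of_int ?k \<le> x"
    using ulp_grid_mem[OF p k1 k2] by blast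
  fix y assume y: "y \<in> fp_numbers p \<and> y \<le> x"
  show "y \<le> ?g * of_int ?k"
  proof (cases "2 powi expo x \<le> \<bar>y\<bar>")
    case True
    then obtain j :: int where j: "y = ?g * of_int j" using ulp_gridI[OF p] y by blast
    then have "of_int j \<le> x / ?g" using y g by (simp add: field_simps)
    then have "j \<le> ?k" by (simp add: le_floor_iff)
    then show ?thesis using j g by simp
  next
    case False
    then have "x > 0" using expo_bounds(1)[OF x] y by linarith
    then have "x / ?g > 0" using g by simp
    then have "?k \<ge> 0" by simp
    then have "real_of_int (2 ^ (p - 1)) \<le> of_int ?k" using k1 by (simp only: of_int_le_iff abs_of_nonneg)
    then have "?g * 2 ^ (p - 1) \<le> ?g * of_int ?k" using g by simp
    then show ?thesis using False ulp_mult[OF p, of x] by simp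
  qed
qed

lemma fl_trunc_eq:
  assumes "q \<ge> 1"
  shows "fl_trunc q x = sgn x * (ulp q x * of_int \<lfloor>\<bar>x\<bar> / ulp q x\<rfloor>)"
proof -
  have "2 powi expo x = ulp q x * 2 ^ (q - 1)" using ulp_mult[OF assms, of x] by simp
  then show ?thesis by (simp add: fl_trunc_def significand_def)
qed

lemma sr_prob_bounds:
  assumes p: "p \<ge> 1" and x: "x \<noteq> 0"
  shows "0 \<le> sr_prob p r x" "sr_prob p r x \<le> 1"
proof -
  define g where "g = ulp p x"
  define h where "h = ulp (p + r) x"
  define k where "k = \<lfloor>x / g\<rfloor>"
  have h: "h > 0" and g: "g > 0" by (simp_all add: h_def g_def ulp_pos)
  have "g = 2 powi (expo x - int (p + r) + 1 + int r)"
    unfolding g_def ulp_def by (simp add: algebra_simps)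
  also have "\<dots> = h * 2 powi int r"
    unfolding h_def ulp_def by (rule power_int_add) simp
  finally have gh: "g = h * 2 ^ r" by simp
  have k: "g * of_int k \<le> x" "x < g * of_int (k + 1)"
  proof -
    have "of_int k \<le> x / g" "x / g < of_int (k + 1)" unfolding k_def by linarith+
    then show "g * of_int k \<le> x" "x < g * of_int (k + 1)" using g by (simp_all add: field_simps)
  qed
  define l where "l = \<lfloor>\<bar>x\<bar> / h\<rfloor>"
  have "of_int l \<le> \<bar>x\<bar> / h" unfolding l_def by simp
  then have l: "h * of_int l \<le> \<bar>x\<bar>" using h by (simp add: field_simps)
  have lI: "h * of_int j \<le> h * of_int l" if "h * of_int j \<le> \<bar>x\<bar>" for j
  proof -
    have "of_int j \<le> \<bar>x\<bar> / h" using that h by (simp add: field_simps)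
    then show ?thesis using h by (simp add: l_def le_floor_iff)
  qed
  have fl: "fl_trunc (p + r) x = sgn x * (h * of_int l)"
    unfolding h_def l_def by (rule fl_trunc_eq) (use p in simp)
  have "g * of_int k \<le> fl_trunc (p + r) x \<and> fl_trunc (p + r) x \<le> g * of_int (k + 1)"
  proof (cases "x > 0")
    case True
    have "h * of_int (2 ^ r * k) \<le> \<bar>x\<bar>" using k(1) True by (simp add: gh mult.assoc)
    from lI[OF this] show ?thesis using l k True unfolding fl by (simp add: gh mult.assoc)
  next
    case False
    have "h * of_int (- (2 ^ r * (k + 1))) \<le> \<bar>x\<bar>" using k(2) False by (simp add: gh mult.assoc)
    from lI[OF this] show ?thesis using l k False x unfolding fl by (simp add: gh mult.assoc)
  qed
  then show "0 \<le> sr_prob p r x" "sr_prob p r x \<le> 1"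
    unfolding sr_prob_def fp_floor_eq[OF p x] g_def[symmetric] k_def[symmetric]
    using g by (simp_all add: field_simps)
qed

end

theory Submission
  imports Defs
begin

text \<open>
  One stochastic rounding of a real number \<open>x\<close> has expectation exactly \<open>fl_trunc (p + r) x\<close>: the
  probability of rounding up is chosen for that purpose, and if \<open>x\<close> is itself a floating-point
  number, then both outcomes and the truncation equal \<open>x\<close> (\<open>expectation_SR\<close>). Truncation acts towards zero with relative
  error at most the unit roundoff \<open>u\<close> of precision \<open>p + r\<close>, so one rounding has bias at most
  \<open>u * \<bar>x\<bar>\<close>. The two possible outcomes never lie on opposite sides of zero, hence
  \<open>E \<bar>SR x\<bar> = \<bar>E (SR x)\<bar> = \<bar>fl_trunc (p + r) x\<bar> \<le> \<bar>x\<bar>\<close>.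

  The second fact makes the expected absolute value of the \<open>k\<close>-th computed partial sum at most
  \<open>\<bar>a 1\<bar> + \<dots> + \<bar>a k\<bar>\<close> (\<open>expectation_abs_sr_sum_le\<close>). The first then bounds the bias
  added by each of the \<open>n - 1\<close> additions by \<open>u * (\<bar>a 1\<bar> + \<dots> + \<bar>a n\<bar>)\<close>
  (\<open>sr_sum_bias_le\<close>). The total bias is thus at most \<open>(n - 1) * u\<close> times the sum of the
  \<open>\<bar>a i\<bar>\<close>, and \<open>(n - 1) * u \<le> (1 + u) ^ (n - 1) - 1\<close> by Bernoulli's inequality. No martingale
  argument is needed, and the errors accumulate only linearly.
\<close>

lemma fp_ceil_eq:
  assumes p: "p \<ge> 1" and x: "x \<noteq> 0"
  shows "fp_ceil p x = ulp p x * of_int \<lceil>x / ulp p x\<rceil>"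
  unfolding fp_ceil_def
proof (rule Least_equality)
  let ?g = "ulp p x" and ?k = "\<lceil>x / ulp p x\<rceil>"
  note g = ulp_pos[of p x]
  note b = ulp_scaled_bounds[OF p x]
  have k: "2 ^ (p - 1) \<le> \<bar>?k\<bar> \<and> \<bar>?k\<bar> \<le> 2 ^ p"
  proof (cases "x > 0")
    case True
    then have "x / ?g > 0" using g by simp
    then have "real_of_int (2 ^ (p - 1)) \<le> x / ?g" "x / ?g \<le> real_of_int (2 ^ p)"
      using b unfolding of_int_power of_int_numeral by linarith+
    then have "2 ^ (p - 1) \<le> ?k" "?k \<le> 2 ^ p"
      by linarith (simp only: ceiling_le_iff \<open>x / ?g \<le> real_of_int (2 ^ p)\<close>)
    moreover have "(0::int) < 2 ^ (p - 1)" by simp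
    ultimately show ?thesis by linarith
  next
    case False
    then have "x / ?g < 0" using g x by (simp add: divide_neg_pos)
    then have "x / ?g \<le> real_of_int (- (2 ^ (p - 1)))" "real_of_int (- (2 ^ p)) \<le> x / ?g"
      using b unfolding of_int_minus of_int_power of_int_numeral by linarith+
    then have "?k \<le> - (2 ^ (p - 1))" "real_of_int (- (2 ^ p)) \<le> real_of_int ?k"
      by (simp only: ceiling_le_iff) (rule order_trans[OF \<open>real_of_int (- (2 ^ p)) \<le> x / ?g\<close> le_of_int_ceiling])
    then have "?k \<le> - (2 ^ (p - 1))" "- (2 ^ p) \<le> ?k" by (simp_all only: of_int_le_iff)
    moreover have "(0::int) < 2 ^ (p - 1)" by simp
    ultimately show ?thesis by linarith
  qed
  have "x / ?g \<le> of_int ?k" by simp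
  then have "x \<le> ?g * of_int ?k" using g by (simp only: pos_divide_le_eq mult.commute)
  then show "?g * of_int ?k \<in> fp_numbers p \<and> ?g * of_int ?k \<ge> x"
    using ulp_grid_mem[OF p] k by blast
  fix y assume y: "y \<in> fp_numbers p \<and> y \<ge> x"
  show "?g * of_int ?k \<le> y"
  proof (cases "2 powi expo x \<le> \<bar>y\<bar>")
    case True
    then obtain j :: int where j: "y = ?g * of_int j" using ulp_gridI[OF p] y by blast
    then have "x / ?g \<le> of_int j" using y g by (simp add: field_simps)
    then have "?k \<le> j" by (simp add: ceiling_le_iff)
    then show ?thesis using j g by simp
  next
    \<comment> \<open>Here \<open>y\<close> lies below the binade of \<open>x\<close>, so \<open>x\<close> is negative and the candidate is at most
      \<open>- (2 powi expo x)\<close>.\<close>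
    case False
    then have "x < 0" using expo_bounds(1)[OF x] y by linarith
    then have "x / ?g \<le> 0" using g by (simp add: divide_nonpos_pos)
    then have "?k \<le> 0" by simp
    then have "?k \<le> - (2 ^ (p - 1))" using k by linarith
    then have "real_of_int ?k \<le> real_of_int (- (2 ^ (p - 1)))" by (simp only: of_int_le_iff)
    then have "?g * of_int ?k \<le> ?g * (- (2 ^ (p - 1)))"
      using g by (intro mult_left_mono) auto
    then show ?thesis using False ulp_mult[OF p, of x] by simp
  qed
qed

text \<open>Rounding to precision \<open>p\<close> never crosses zero.\<close>

lemma fp_floor_nonneg: "0 \<le> fp_floor p x" if "p \<ge> 1" "x > 0"
  using that ulp_pos[of p x] by (simp add: fp_floor_eq)

lemma fp_ceil_nonneg: "0 \<le> fp_ceil p x" if "p \<ge> 1" "x > 0"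
proof -
  have "0 < x / ulp p x" using that ulp_pos[of p x] by simp
  then have "0 \<le> \<lceil>x / ulp p x\<rceil>" by linarith
  then show ?thesis using that ulp_pos[of p x] by (simp add: fp_ceil_eq)
qed

lemma fp_floor_nonpos: "fp_floor p x \<le> 0" if "p \<ge> 1" "x < 0"
proof -
  have "x / ulp p x < 0" using that ulp_pos[of p x] by (simp add: divide_neg_pos)
  then have "\<lfloor>x / ulp p x\<rfloor> \<le> 0" by linarith
  then show ?thesis using that ulp_pos[of p x] by (simp add: fp_floor_eq mult_nonneg_nonpos)
qed

lemma fp_ceil_nonpos: "fp_ceil p x \<le> 0" if "p \<ge> 1" "x < 0"
proof -
  have "x / ulp p x < 0" using that ulp_pos[of p x] by (simp add: divide_neg_pos)
  then have "\<lceil>x / ulp p x\<rceil> \<le> 0" by linarith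
  then show ?thesis using that ulp_pos[of p x] by (simp add: fp_ceil_eq mult_nonneg_nonpos)
qed

lemma ulp_le_unit_roundoff:
  assumes "x \<noteq> 0"
  shows "ulp q x \<le> unit_roundoff q * \<bar>x\<bar>"
proof -
  have "ulp q x = 2 powi (1 - int q + expo x)" unfolding ulp_def by (simp add: algebra_simps)
  also have "\<dots> = unit_roundoff q * 2 powi expo x"
    unfolding unit_roundoff_def by (rule power_int_add) simp
  also have "\<dots> \<le> unit_roundoff q * \<bar>x\<bar>"
    using expo_bounds(1)[OF assms] by (intro mult_left_mono) (auto simp: unit_roundoff_def)
  finally show ?thesis .
qed

lemma fl_trunc_abs_le:
  assumes "q \<ge> 1"
  shows "\<bar>fl_trunc q x\<bar> \<le> \<bar>x\<bar>"
proof -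
  have h: "ulp q x > 0" by (rule ulp_pos)
  have "real_of_int \<lfloor>\<bar>x\<bar> / ulp q x\<rfloor> \<le> \<bar>x\<bar> / ulp q x" by simp
  then have "ulp q x * real_of_int \<lfloor>\<bar>x\<bar> / ulp q x\<rfloor> \<le> \<bar>x\<bar>"
    using h by (simp only: pos_le_divide_eq mult.commute)
  moreover have "0 \<le> real_of_int \<lfloor>\<bar>x\<bar> / ulp q x\<rfloor>" using h by simp
  ultimately show ?thesis
    using h unfolding fl_trunc_eq[OF assms] by (simp add: abs_mult abs_sgn_eq)
qed

lemma fl_trunc_error_le:
  assumes "q \<ge> 1"
  shows "\<bar>fl_trunc q x - x\<bar> \<le> unit_roundoff q * \<bar>x\<bar>"
proof (cases "x = 0")
  case True
  then show ?thesis by (simp add: fl_trunc_def)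
next
  case False
  define l where "l = real_of_int \<lfloor>\<bar>x\<bar> / ulp q x\<rfloor>"
  have h: "ulp q x > 0" by (rule ulp_pos)
  have "l \<le> \<bar>x\<bar> / ulp q x" "\<bar>x\<bar> / ulp q x \<le> l + 1" unfolding l_def by linarith+
  then have *: "ulp q x * l \<le> \<bar>x\<bar>" "\<bar>x\<bar> \<le> ulp q x * l + ulp q x"
    using h by (simp_all add: field_simps)
  have "fl_trunc q x - x = sgn x * (ulp q x * l - \<bar>x\<bar>)"
    unfolding fl_trunc_eq[OF assms] l_def[symmetric] by (simp only: right_diff_distrib sgn_mult_abs)
  then have "\<bar>fl_trunc q x - x\<bar> = \<bar>ulp q x * l - \<bar>x\<bar>\<bar>"
    using False by (simp add: abs_mult abs_sgn_eq)
  also have "\<dots> \<le> ulp q x" using * by linarith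
  also have "\<dots> \<le> unit_roundoff q * \<bar>x\<bar>" by (rule ulp_le_unit_roundoff[OF False])
  finally show ?thesis .
qed

text \<open>A nonzero \<open>x\<close> is an integer multiple of its own ulp iff it is a floating-point number of
  precision \<open>p\<close>; extra bits then make truncation exact.\<close>

lemma fl_trunc_eq_self:
  assumes p: "p \<ge> 1" and k: "x / ulp p x = of_int k"
  shows "fl_trunc (p + r) x = x"
proof -
  have "ulp p x = 2 powi (expo x - int (p + r) + 1 + int r)"
    unfolding ulp_def by (simp add: algebra_simps)
  also have "\<dots> = ulp (p + r) x * 2 powi int r"
    unfolding ulp_def by (rule power_int_add) simp
  finally have g: "ulp p x = ulp (p + r) x * 2 ^ r" by simp
  have h: "ulp (p + r) x > 0" by (rule ulp_pos)
  have "x = ulp (p + r) x * 2 ^ r * of_int k"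
    using k h unfolding g by (simp add: nonzero_divide_eq_eq mult.commute)
  then have "\<bar>x\<bar> = \<bar>ulp (p + r) x * 2 ^ r * of_int k\<bar>" by (rule arg_cong)
  also have "\<dots> = ulp (p + r) x * of_int (2 ^ r * \<bar>k\<bar>)" using h by (simp add: abs_mult)
  finally have "\<bar>x\<bar> = ulp (p + r) x * of_int (2 ^ r * \<bar>k\<bar>)" .
  then have "\<bar>x\<bar> / ulp (p + r) x = of_int (2 ^ r * \<bar>k\<bar>)"
    using h by (metis less_irrefl nonzero_mult_div_cancel_left)
  then have fl: "of_int \<lfloor>\<bar>x\<bar> / ulp (p + r) x\<rfloor> = \<bar>x\<bar> / ulp (p + r) x"
    by (metis floor_of_int)
  have "fl_trunc (p + r) x = sgn x * (ulp (p + r) x * (\<bar>x\<bar> / ulp (p + r) x))"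
    using p by (subst fl_trunc_eq) (simp_all add: fl)
  also have "\<dots> = x" using h by (simp add: sgn_mult_abs)
  finally show ?thesis .
qed

lemma finite_set_SR: "finite (set_pmf (SR p r x))"
proof -
  have "finite (set_pmf (bernoulli_pmf q))" for q by (rule finite_subset[of _ UNIV]) auto
  then show ?thesis by (simp add: SR_def)
qed

lemma expectation_SR_gen:
  fixes f :: "real \<Rightarrow> real"
  assumes "p \<ge> 1" and "x \<noteq> 0"
  shows "measure_pmf.expectation (SR p r x) f =
    sr_prob p r x * f (fp_ceil p x) + (1 - sr_prob p r x) * f (fp_floor p x)"
  using assms sr_prob_bounds[OF assms, of r] by (simp add: SR_def)

text \<open>Limited-precision stochastic rounding is an unbiased rounding of the truncation of \<open>x\<close>
  to \<open>p + r\<close> bits.\<close>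

lemma expectation_SR:
  assumes p: "p \<ge> 1"
  shows "measure_pmf.expectation (SR p r x) (\<lambda>s. s) = fl_trunc (p + r) x"
proof (cases "x = 0")
  case True
  then show ?thesis by (simp add: SR_def fl_trunc_def)
next
  case x: False
  have E: "measure_pmf.expectation (SR p r x) (\<lambda>s. s) =
      fp_floor p x + sr_prob p r x * (fp_ceil p x - fp_floor p x)"
    unfolding expectation_SR_gen[OF p x] by (simp add: algebra_simps)
  have g: "ulp p x > 0" by (rule ulp_pos)
  show ?thesis
  proof (cases "x / ulp p x \<in> \<int>")
    case True
    then obtain k where k: "x / ulp p x = of_int k" by (auto elim: Ints_cases)
    then have "ulp p x * of_int k = x" using g by (simp add: field_simps)
    then have "fp_floor p x = x" "fp_ceil p x = x"
      by (simp_all add: fp_floor_eq[OF p x] fp_ceil_eq[OF p x] k)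
    then show ?thesis unfolding E fl_trunc_eq_self[OF p k] by simp
  next
    \<comment> \<open>The two candidates are one ulp apart, which is the denominator of the rounding-up
      probability.\<close>
    case False
    then have "\<lceil>x / ulp p x\<rceil> = \<lfloor>x / ulp p x\<rfloor> + 1" by (metis Ints_of_int ceiling_altdef)
    then have "fp_ceil p x - fp_floor p x = ulp p x"
      unfolding fp_floor_eq[OF p x] fp_ceil_eq[OF p x] by (simp add: algebra_simps)
    then show ?thesis unfolding E sr_prob_def using g by simp
  qed
qed

text \<open>As both outcomes have weakly the same sign, the absolute value commutes with the
  expectation, and truncation towards zero does the rest.\<close>

lemma expectation_abs_SR_le:
  assumes p: "p \<ge> 1"
  shows "measure_pmf.expectation (SR p r x) abs \<le> \<bar>x\<bar>"
proof (cases "x = 0")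
  case True
  then show ?thesis by (simp add: SR_def)
next
  case x: False
  have "measure_pmf.expectation (SR p r x) abs = \<bar>measure_pmf.expectation (SR p r x) (\<lambda>s. s)\<bar>"
  proof (cases "x > 0")
    case True
    then have *: "0 \<le> fp_floor p x" "0 \<le> fp_ceil p x"
      using fp_floor_nonneg fp_ceil_nonneg p by auto
    then have "0 \<le> sr_prob p r x * fp_ceil p x + (1 - sr_prob p r x) * fp_floor p x"
      using sr_prob_bounds[OF p x, of r] by simp
    then show ?thesis unfolding expectation_SR_gen[OF p x] using * by simp
  next
    case False
    then have *: "fp_floor p x \<le> 0" "fp_ceil p x \<le> 0"
      using fp_floor_nonpos fp_ceil_nonpos p x by auto
    then have "sr_prob p r x * fp_ceil p x + (1 - sr_prob p r x) * fp_floor p x \<le> 0"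
      using sr_prob_bounds[OF p x, of r] by (intro add_nonpos_nonpos mult_nonneg_nonpos) auto
    then show ?thesis unfolding expectation_SR_gen[OF p x] using * by simp
  qed
  also have "\<dots> \<le> \<bar>x\<bar>" unfolding expectation_SR[OF p] using p by (intro fl_trunc_abs_le) simp
  finally show ?thesis .
qed

lemma finite_set_sr_sum: "finite (set_pmf (sr_sum p r a k))"
  by (induction p r a k rule: sr_sum.induct) (auto simp: finite_set_SR)

lemma integrable_sr_sum:
  fixes f :: "real \<Rightarrow> real"
  shows "integrable (sr_sum p r a k) f"
  by (rule integrable_measure_pmf_finite[OF finite_set_sr_sum])

lemma expectation_sr_sum_Suc:
  fixes f :: "real \<Rightarrow> real"
  shows "measure_pmf.expectation (sr_sum p r a (Suc (Suc k))) f =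
    measure_pmf.expectation (sr_sum p r a (Suc k))
      (\<lambda>s. measure_pmf.expectation (SR p r (s + a (Suc (Suc k)))) f)"
  unfolding sr_sum.simps
  by (subst pmf_expectation_bind[where A = "set_pmf (sr_sum p r a (Suc k))"],
      auto simp: finite_set_sr_sum finite_set_SR integral_measure_pmf[OF finite_set_sr_sum])

lemma expectation_abs_sr_sum_step:
  "measure_pmf.expectation (sr_sum p r a k) (\<lambda>s. \<bar>s + c\<bar>) \<le>
     measure_pmf.expectation (sr_sum p r a k) abs + \<bar>c\<bar>"
proof -
  have "measure_pmf.expectation (sr_sum p r a k) (\<lambda>s. \<bar>s + c\<bar>) \<le>
      measure_pmf.expectation (sr_sum p r a k) (\<lambda>s. \<bar>s\<bar> + \<bar>c\<bar>)"
    by (intro integral_mono integrable_sr_sum abs_triangle_ineq)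
  also have "\<dots> = measure_pmf.expectation (sr_sum p r a k) abs + \<bar>c\<bar>"
    by (subst Bochner_Integration.integral_add) (auto intro: integrable_sr_sum)
  finally show ?thesis .
qed

lemma expectation_abs_sr_sum_le:
  assumes p: "p \<ge> 1"
  shows "measure_pmf.expectation (sr_sum p r a (Suc k)) abs \<le> (\<Sum>i=1..Suc k. \<bar>a i\<bar>)"
proof (induction k)
  case 0
  show ?case by simp
next
  case (Suc k)
  have "measure_pmf.expectation (sr_sum p r a (Suc (Suc k))) abs \<le>
      measure_pmf.expectation (sr_sum p r a (Suc k)) (\<lambda>s. \<bar>s + a (Suc (Suc k))\<bar>)"
    unfolding expectation_sr_sum_Suc
    by (intro integral_mono integrable_sr_sum expectation_abs_SR_le[OF p])
  also have "\<dots> \<le> measure_pmf.expectation (sr_sum p r a (Suc k)) abs + \<bar>a (Suc (Suc k))\<bar>"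
    by (rule expectation_abs_sr_sum_step)
  also have "\<dots> \<le> (\<Sum>i=1..Suc (Suc k). \<bar>a i\<bar>)" using Suc.IH by simp
  finally show ?case .
qed

text \<open>Each of the \<open>k\<close> additions contributes at most the unit roundoff times the whole sum of
  absolute values, so the bias relative to that sum is at most linear in \<open>k\<close>.\<close>

lemma sr_sum_bias_le:
  assumes p: "p \<ge> 1"
  shows "\<bar>measure_pmf.expectation (sr_sum p r a (Suc k)) (\<lambda>s. s) - (\<Sum>i=1..Suc k. a i)\<bar>
    \<le> real k * unit_roundoff (p + r) * (\<Sum>i=1..Suc k. \<bar>a i\<bar>)"
proof (induction k)
  case 0
  show ?case by simp
next
  case (Suc k)
  let ?M = "sr_sum p r a (Suc k)" and ?c = "a (Suc (Suc k))" and ?u = "unit_roundoff (p + r)"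
  let ?A = "\<Sum>i=1..Suc k. \<bar>a i\<bar>"
  have u: "?u \<ge> 0" by (simp add: unit_roundoff_def)
  \<comment> \<open>New bias, committed by the last rounding, plus the inherited one.\<close>
  have split: "measure_pmf.expectation (sr_sum p r a (Suc (Suc k))) (\<lambda>s. s) =
      measure_pmf.expectation ?M (\<lambda>s. fl_trunc (p + r) (s + ?c) - (s + ?c)) +
      (measure_pmf.expectation ?M (\<lambda>s. s) + ?c)"
    unfolding expectation_sr_sum_Suc expectation_SR[OF p]
    by (simp add: Bochner_Integration.integral_diff Bochner_Integration.integral_add integrable_sr_sum)
  have "\<bar>measure_pmf.expectation ?M (\<lambda>s. fl_trunc (p + r) (s + ?c) - (s + ?c))\<bar> \<le>
      measure_pmf.expectation ?M (\<lambda>s. \<bar>fl_trunc (p + r) (s + ?c) - (s + ?c)\<bar>)"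
    by (rule integral_abs_bound)
  also have "\<dots> \<le> measure_pmf.expectation ?M (\<lambda>s. ?u * \<bar>s + ?c\<bar>)"
    using p by (intro integral_mono integrable_sr_sum fl_trunc_error_le) simp
  also have "\<dots> = ?u * measure_pmf.expectation ?M (\<lambda>s. \<bar>s + ?c\<bar>)" by simp
  also have "\<dots> \<le> ?u * (?A + \<bar>?c\<bar>)"
    using expectation_abs_sr_sum_step[of p r a "Suc k" ?c] expectation_abs_sr_sum_le[OF p, of r a k]
    by (intro mult_left_mono u) linarith
  finally have step: "\<bar>measure_pmf.expectation ?M (\<lambda>s. fl_trunc (p + r) (s + ?c) - (s + ?c))\<bar>
      \<le> ?u * (?A + \<bar>?c\<bar>)" .
  have "\<bar>measure_pmf.expectation (sr_sum p r a (Suc (Suc k))) (\<lambda>s. s) - (\<Sum>i=1..Suc (Suc k). a i)\<bar> =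
      \<bar>measure_pmf.expectation ?M (\<lambda>s. fl_trunc (p + r) (s + ?c) - (s + ?c)) +
        (measure_pmf.expectation ?M (\<lambda>s. s) - (\<Sum>i=1..Suc k. a i))\<bar>"
    unfolding split by (simp add: algebra_simps)
  also have "\<dots> \<le> ?u * (?A + \<bar>?c\<bar>) + real k * ?u * ?A"
    by (rule order_trans[OF abs_triangle_ineq add_mono[OF step Suc.IH]])
  also have "\<dots> \<le> ?u * (?A + \<bar>?c\<bar>) + real k * ?u * (?A + \<bar>?c\<bar>)"
    using u by (intro add_left_mono mult_left_mono) auto
  also have "\<dots> = real (Suc k) * ?u * (\<Sum>i=1..Suc (Suc k). \<bar>a i\<bar>)"
    by (simp add: algebra_simps)
  finally show ?case .
qed

theorem theorem2:
  fixes p r n :: nat and a :: "nat \<Rightarrow> real" and y :: real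
  assumes "p \<ge> 1" and "r \<ge> 1" and "n \<ge> 1"
    and "y = (\<Sum>i=1..n. a i)" and "y \<noteq> 0"
  shows "\<bar>measure_pmf.expectation (sr_sum p r a n) (\<lambda>s. s) - y\<bar> / \<bar>y\<bar>
           \<le> cond_sum n a * gamma_bound (n - 1) (unit_roundoff (p + r))"
proof -
  let ?u = "unit_roundoff (p + r)" and ?A = "\<Sum>i=1..n. \<bar>a i\<bar>"
  have n: "n = Suc (n - 1)" using assms(3) by simp
  have "?u \<ge> 0" by (simp add: unit_roundoff_def)
  then have "real (n - 1) * ?u \<le> gamma_bound (n - 1) ?u"
    using Bernoulli_inequality[of ?u "n - 1"] unfolding gamma_bound_def by linarith
  then have "real (n - 1) * ?u * ?A \<le> gamma_bound (n - 1) ?u * ?A"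
    by (intro mult_right_mono sum_nonneg) auto
  moreover have "\<bar>measure_pmf.expectation (sr_sum p r a n) (\<lambda>s. s) - y\<bar> \<le> real (n - 1) * ?u * ?A"
    using sr_sum_bias_le[OF assms(1), of r a "n - 1"] unfolding n[symmetric] assms(4) .
  ultimately have "\<bar>measure_pmf.expectation (sr_sum p r a n) (\<lambda>s. s) - y\<bar> / \<bar>y\<bar>
      \<le> (gamma_bound (n - 1) ?u * ?A) / \<bar>y\<bar>"
    by (intro divide_right_mono) auto
  then show ?thesis unfolding cond_sum_def assms(4) by (simp add: mult.commute)
qed

end
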